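(* Let $\mathcal{D}\subseteq\mathbb{R}^d$, let $\boldsymbol{K}:\mathcal{D}\times\mathcal{D}\to\mathbb{R}^{n\times n}$ be a positive definite kernel and let $X=\{\boldsymbol{x}_1,\dots,\boldsymbol{x}_N\}\subseteq\mathcal{D}$ consist of pairwise distinct points. Let $V_X=\{\sum_{j=1}^N\boldsymbol{K}(\cdot,\boldsymbol{x}_j)\boldsymbol{\beta}_j:\boldsymbol{\beta}_j\in\mathbb{R}^n,\ 1\le j\le N\}$ and let $\mathcal{H}=\mathcal{H}(\mathcal{D})$ be the reproducing kernel Hilbert space of $\boldsymbol{K}$. 1. For every $\boldsymbol{Y}=(\boldsymbol{y}_1,\dots,\boldsymbol{y}_N)$ with $\boldsymbol{y}_i\in\mathbb{R}^n$ there is a unique function $\boldsymbol{s}_{0,\boldsymbol{Y}}\in V_X$ with $\boldsymbol{s}_{0,\boldsymbol{Y}}(\boldsymbol{x}_i)=\boldsymbol{y}_i$, $1\le i\le N$. This defines an interpolation operator $\boldsymbol{I}_X$ by $\boldsymbol{I}_X\boldsymbol{Y}:=\boldsymbol{s}_{0,\boldsymbol{Y}}$, and also an operator $\boldsymbol{I}_X:C(\mathcal{D})^n\to V_X$ by $\boldsymbol{I}_X\boldsymbol{v}:=\boldsymbol{I}_X(\boldsymbol{v}|X)$, where $\boldsymbol{v}|X=(\boldsymbol{v}(\boldsymbol{x}_1),\dots,\boldsymbol{v}(\boldsymbol{x}_N))$. 2. The function $\boldsymbol{s}_{0,\boldsymbol{Y}}$ is the solution of $\min\{\|\boldsymbol{s}\|_{\mathcal{H}}:\boldsymbol{s}\in\mathcal{H},\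 \boldsymbol{s}(\boldsymbol{x}_i)=\boldsymbol{y}_i,\ 1\le i\le N\}$. 3. For $\boldsymbol{v},\boldsymbol{m}\in C(\mathcal{D})^n$, the noise-free predictive mean $\boldsymbol{m}_N$ with data $\boldsymbol{y}_j=\boldsymbol{v}(\boldsymbol{x}_j)$, prior mean $\boldsymbol{m}$ and prior covariance $\boldsymbol{K}$ satisfies $\boldsymbol{m}_N=\boldsymbol{m}+\boldsymbol{I}_X\boldsymbol{v}-\boldsymbol{I}_X\boldsymbol{m}$. 4. The noise-free predictive covariance kernel $\boldsymbol{K}_N$ satisfies, for all $\boldsymbol{x},\boldsymbol{x}'\in\mathcal{D}$, $$\boldsymbol{K}_N(\boldsymbol{x},\boldsymbol{x}')=\boldsymbol{K}(\boldsymbol{x},\boldsymbol{x}')-\boldsymbol{I}_X\boldsymbol{K}(\cdot,\boldsymbol{x}')(\boldsymbol{x})=\boldsymbol{K}(\boldsymbol{x},\boldsymbol{x}')-\bigl[\boldsymbol{I}_X\boldsymbol{K}(\cdot,\boldsymbol{x})(\boldsymbol{x}')\bigr]^{\mathrm T},$$ where $\boldsymbol{I}_X$ is applied to each column of the matrix-valued kernel. Moreover, the predictive variance $\boldsymbol{\sigma}_N^2(\boldsymbol{x}):=\boldsymbol{K}_N(\boldsymbol{x},\boldsymbol{x})\in\mathbb{R}^{n\times n}$ satisfies $$\|\boldsymbol{\sigma}_N^2(\boldsymbol{x})\|_2=\lambda_{\max}(\boldsymbol{\sigma}_N^2(\boldsymbol{x}))=\sup_{\boldsymbol{v}\in\mathcal{H},\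 \|\boldsymbol{v}\|_{\mathcal{H}}=1}\|\boldsymbol{v}(\boldsymbol{x})-\boldsymbol{I}_X\boldsymbol{v}(\boldsymbol{x})\|_2^2,$$ where $\lambda_{\max}$ denotes the maximal eigenvalue.
   Context: A continuous map $\boldsymbol{K}:\mathcal{D}\times\mathcal{D}\to\mathbb{R}^{n\times n}$ is positive definite if $\boldsymbol{K}(\boldsymbol{x},\boldsymbol{x}')^{\mathrm T}=\boldsymbol{K}(\boldsymbol{x}',\boldsymbol{x})$ for all $\boldsymbol{x},\boldsymbol{x}'$ and $\sum_{i,j=1}^N\boldsymbol{w}_i^{\mathrm T}\boldsymbol{K}(\boldsymbol{x}_i,\boldsymbol{x}_j)\boldsymbol{w}_j>0$ for all $N$, all pairwise distinct $\boldsymbol{x}_1,\dots,\boldsymbol{x}_N\in\mathcal{D}$ and all $\boldsymbol{w}_1,\dots,\boldsymbol{w}_N\in\mathbb{R}^n$ not all zero. A Hilbert space $\mathcal{H}$ of functions $\mathcal{D}\to\mathbb{R}^n$ is the reproducing kernel Hilbert space (RKHS) of $\boldsymbol{K}$ if $\boldsymbol{K}(\cdot,\boldsymbol{x})\boldsymbol{w}\in\mathcal{H}$ and $\boldsymbol{v}(\boldsymbol{x})^{\mathrm T}\boldsymbol{w}=\langle\boldsymbol{v},\boldsymbol{K}(\cdot,\boldsymbol{x})\boldsymbol{w}\rangle_{\mathcal{H}}$ for all $\boldsymbol{v}\in\mathcal{H}$, $\boldsymbol{x}\in\mathcal{D}$, $\boldsymbol{w}\in\mathbb{R}^n$. Every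 positive definite kernel has a unique RKHS, contained in $C(\mathcal{D})^n$. Block notation: $\boldsymbol{K}(\boldsymbol{x},X)=(\boldsymbol{K}(\boldsymbol{x},\boldsymbol{x}_1),\dots,\boldsymbol{K}(\boldsymbol{x},\boldsymbol{x}_N))\in\mathbb{R}^{n\times nN}$, $\boldsymbol{K}(X,X)=(\boldsymbol{K}(\boldsymbol{x}_i,\boldsymbol{x}_j))_{i,j}\in\mathbb{R}^{nN\times nN}$; $\boldsymbol{m}(X)=(\boldsymbol{m}(\boldsymbol{x}_1),\dots,\boldsymbol{m}(\boldsymbol{x}_N))$ and $\boldsymbol{Y}$ are regarded as column vectors in $\mathbb{R}^{nN}$. The noise-free predictive mean and covariance are $$\boldsymbol{m}_N(\boldsymbol{x})=\boldsymbol{m}(\boldsymbol{x})+\boldsymbol{K}(\boldsymbol{x},X)\boldsymbol{K}(X,X)^{-1}(\boldsymbol{Y}-\boldsymbol{m}(X)),\qquad \boldsymbol{K}_N(\boldsymbol{x},\boldsymbol{x}')=\boldsymbol{K}(\boldsymbol{x},\boldsymbol{x}')-\boldsymbol{K}(\boldsymbol{x},X)\boldsymbol{K}(X,X)^{-1}\boldsymbol{K}(\boldsymbol{x}',X)^{\mathrm T}.$$ $\|\cdot\|_2$ denotes the Euclidean norm of vectors and the spectral norm of matrices. *)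

theory Defs
  imports "HOL-Analysis.Analysis"
begin

text \<open>A function on \<^term>\<open>D\<close> is represented by its extension by \<^term>\<open>0\<close> to the whole type.
  Hence equality of such representatives is equality of functions on \<^term>\<open>D\<close>,
  and they are closed under pointwise linear combinations.\<close>

definition fun_on :: "'a set \<Rightarrow> ('a \<Rightarrow> 'b::zero) \<Rightarrow> 'a \<Rightarrow> 'b" where
  "fun_on D f = (\<lambda>y. if y \<in> D then f y else 0)"

definition pd_kernel :: "(real^'d) set \<Rightarrow> (real^'d \<Rightarrow> real^'d \<Rightarrow> real^'n^'n) \<Rightarrow> bool" where
  "pd_kernel D K \<longleftrightarrow>
     continuous_on (D \<times> D) (\<lambda>(x, x'). K x x') \<and>
     (\<forall>x\<in>D. \<forall>x'\<in>D. transpose (K x x') = K x' x) \<and>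
     (\<forall>(N::nat) (x :: nat \<Rightarrow> real^'d) (w :: nat \<Rightarrow> real^'n).
        x ` {..<N} \<subseteq> D \<longrightarrow> inj_on x {..<N} \<longrightarrow> (\<exists>i<N. w i \<noteq> 0) \<longrightarrow>
        (\<Sum>i<N. \<Sum>j<N. w i \<bullet> (K (x i) (x j) *v w j)) > 0)"

definition ip_norm :: "('f \<Rightarrow> 'f \<Rightarrow> real) \<Rightarrow> 'f \<Rightarrow> real" where
  "ip_norm ip v = sqrt (ip v v)"

text \<open>\<^term>\<open>ip\<close> is the inner product of the space \<^term>\<open>H\<close>; its values outside \<^term>\<open>H\<close> are irrelevant.\<close>

definition hilbert_function_space ::
  "'a set \<Rightarrow> ('a \<Rightarrow> 'b::real_vector) set \<Rightarrow> (('a \<Rightarrow> 'b) \<Rightarrow> ('a \<Rightarrow> 'b) \<Rightarrow> real) \<Rightarrow> bool" where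
  "hilbert_function_space D H ip \<longleftrightarrow>
     (\<forall>v\<in>H. \<forall>y. y \<notin> D \<longrightarrow> v y = 0) \<and>
     (\<lambda>y. 0) \<in> H \<and>
     (\<forall>u\<in>H. \<forall>v\<in>H. (\<lambda>y. u y + v y) \<in> H) \<and>
     (\<forall>c. \<forall>v\<in>H. (\<lambda>y. c *\<^sub>R v y) \<in> H) \<and>
     (\<forall>u\<in>H. \<forall>v\<in>H. ip u v = ip v u) \<and>
     (\<forall>u\<in>H. \<forall>v\<in>H. \<forall>w\<in>H. ip (\<lambda>y. u y + v y) w = ip u w + ip v w) \<and>
     (\<forall>c. \<forall>u\<in>H. \<forall>v\<in>H. ip (\<lambda>y. c *\<^sub>R u y) v = c * ip u v) \<and>
     (\<forall>v\<in>H. v \<noteq> (\<lambda>y. 0) \<longrightarrow> ip v v > 0) \<and>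
     (\<forall>f :: nat \<Rightarrow> 'a \<Rightarrow> 'b.
        (\<forall>k. f k \<in> H) \<longrightarrow>
        (\<forall>e>0. \<exists>M. \<forall>k\<ge>M. \<forall>l\<ge>M. ip_norm ip (\<lambda>y. f k y - f l y) < e) \<longrightarrow>
        (\<exists>v\<in>H. (\<lambda>k. ip_norm ip (\<lambda>y. f k y - v y)) \<longlonglongrightarrow> 0))"

definition is_rkhs ::
  "(real^'d) set \<Rightarrow> (real^'d \<Rightarrow> real^'d \<Rightarrow> real^'n^'n) \<Rightarrow>
   (real^'d \<Rightarrow> real^'n) set \<Rightarrow> ((real^'d \<Rightarrow> real^'n) \<Rightarrow> (real^'d \<Rightarrow> real^'n) \<Rightarrow> real) \<Rightarrow> bool" where
  "is_rkhs D K H ip \<longleftrightarrow>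
     hilbert_function_space D H ip \<and>
     (\<forall>x\<in>D. \<forall>w. fun_on D (\<lambda>y. K y x *v w) \<in> H) \<and>
     (\<forall>v\<in>H. \<forall>x\<in>D. \<forall>w. v x \<bullet> w = ip v (fun_on D (\<lambda>y. K y x *v w)))"

text \<open>The points are a family \<^term>\<open>X\<close> over a finite index type \<^typ>\<open>'p\<close>, so that
  \<open>CARD('p)\<close> is the number of points. Block vectors and block matrices are indexed by the
  product of \<^typ>\<open>'p\<close> (block) and \<^typ>\<open>'n\<close> (position within the block).\<close>

definition block_vec :: "('p::finite \<Rightarrow> real^'n) \<Rightarrow> real^('p \<times> 'n)" where
  "block_vec Y = (\<chi> p. Y (fst p) $ snd p)"

definition kernel_row ::
  "(real^'d \<Rightarrow> real^'d \<Rightarrow> real^'n^'n) \<Rightarrow> ('p::finite \<Rightarrow> real^'d) \<Rightarrow> real^'d \<Rightarrow> real^('p \<times> 'n)^'n" where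
  "kernel_row K X x = (\<chi> a. \<chi> q. K x (X (fst q)) $ a $ snd q)"

definition kernel_matrix ::
  "(real^'d \<Rightarrow> real^'d \<Rightarrow> real^'n^'n) \<Rightarrow> ('p::finite \<Rightarrow> real^'d) \<Rightarrow> real^('p \<times> 'n)^('p \<times> 'n)" where
  "kernel_matrix K X = (\<chi> p. \<chi> q. K (X (fst p)) (X (fst q)) $ snd p $ snd q)"

definition predictive_mean ::
  "(real^'d \<Rightarrow> real^'d \<Rightarrow> real^'n^'n) \<Rightarrow> ('p::finite \<Rightarrow> real^'d) \<Rightarrow> (real^'d \<Rightarrow> real^'n) \<Rightarrow>
   ('p \<Rightarrow> real^'n) \<Rightarrow> real^'d \<Rightarrow> real^'n" where
  "predictive_mean K X m Y x =
     m x + (kernel_row K X x ** matrix_inv (kernel_matrix K X)) *v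
             (block_vec Y - block_vec (\<lambda>i. m (X i)))"

definition predictive_cov ::
  "(real^'d \<Rightarrow> real^'d \<Rightarrow> real^'n^'n) \<Rightarrow> ('p::finite \<Rightarrow> real^'d) \<Rightarrow>
   real^'d \<Rightarrow> real^'d \<Rightarrow> real^'n^'n" where
  "predictive_cov K X x x' =
     K x x' - kernel_row K X x ** matrix_inv (kernel_matrix K X) ** transpose (kernel_row K X x')"

definition kernel_span ::
  "(real^'d) set \<Rightarrow> (real^'d \<Rightarrow> real^'d \<Rightarrow> real^'n^'n) \<Rightarrow> ('p::finite \<Rightarrow> real^'d) \<Rightarrow>
   (real^'d \<Rightarrow> real^'n) set" where
  "kernel_span D K X = {fun_on D (\<lambda>y. \<Sum>j\<in>UNIV. K y (X j) *v \<beta> j) | \<beta> :: 'p \<Rightarrow> real^'n. True}"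

definition interp ::
  "(real^'d) set \<Rightarrow> (real^'d \<Rightarrow> real^'d \<Rightarrow> real^'n^'n) \<Rightarrow> ('p::finite \<Rightarrow> real^'d) \<Rightarrow>
   ('p \<Rightarrow> real^'n) \<Rightarrow> real^'d \<Rightarrow> real^'n" where
  "interp D K X Y = (THE s. s \<in> kernel_span D K X \<and> (\<forall>i. s (X i) = Y i))"

definition interp_fun ::
  "(real^'d) set \<Rightarrow> (real^'d \<Rightarrow> real^'d \<Rightarrow> real^'n^'n) \<Rightarrow> ('p::finite \<Rightarrow> real^'d) \<Rightarrow>
   (real^'d \<Rightarrow> real^'n) \<Rightarrow> real^'d \<Rightarrow> real^'n" where
  "interp_fun D K X v = interp D K X (\<lambda>i. v (X i))"

definition interp_columns ::
  "(real^'d) set \<Rightarrow> (real^'d \<Rightarrow> real^'d \<Rightarrow> real^'n^'n) \<Rightarrow> ('p::finite \<Rightarrow> real^'d) \<Rightarrow>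
   (real^'d \<Rightarrow> real^'n^'n) \<Rightarrow> real^'d \<Rightarrow> real^'n^'n" where
  "interp_columns D K X F y = (\<chi> a c. interp_fun D K X (\<lambda>z. column c (F z)) y $ a)"

definition spectral_norm :: "real^'n^'m \<Rightarrow> real" where
  "spectral_norm A = onorm ((*v) A)"

definition eigenvalues :: "real^'n^'n \<Rightarrow> real set" where
  "eigenvalues A = {l. \<exists>w. w \<noteq> 0 \<and> A *v w = l *\<^sub>R w}"

definition lambda_max :: "real^'n^'n \<Rightarrow> real" where
  "lambda_max A = Max (eigenvalues A)"

end

theory Submission
  imports Defs
begin

text \<open>By the reproducing property, a function of \<open>H\<close> vanishing on \<open>X\<close> is orthogonal to \<open>V\<^sub>X\<close>, so
  \<open>I\<^sub>X\<close> is the orthogonal projection onto \<open>V\<^sub>X\<close>; this gives the minimal norm property. The residual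
  \<open>r\<^sub>w = K(\<cdot>, x) w - I\<^sub>X K(\<cdot>, x) w\<close> satisfies \<open>\<langle>v, r\<^sub>w\<rangle> = (v x - I\<^sub>X v x) \<bullet> w\<close> and
  \<open>\<langle>r\<^sub>w, r\<^sub>u\<rangle> = u \<bullet> K\<^sub>N(x, x) w\<close>. Hence \<open>K\<^sub>N(x, x)\<close> is symmetric and positive semidefinite,
  Cauchy--Schwarz bounds \<open>\<parallel>v x - I\<^sub>X v x\<parallel>\<^sup>2\<close> by its largest eigenvalue, and the normalised residual of
  a leading eigenvector attains the bound.\<close>

section \<open>Symmetric positive semidefinite matrices\<close>

text \<open>The common core of every Cauchy-Schwarz inequality below: the polynomial in
  \<open>t\<close> is a nonnegative quadratic form evaluated at \<open>u + t v\<close>. The form may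
  be degenerate, so \<open>c = 0\<close> is a separate case.\<close>

lemma discriminant_le:
  fixes a b c :: real
  assumes nonneg: "\<And>t. a + 2 * t * b + t\<^sup>2 * c \<ge> 0" and c: "c \<ge> 0"
  shows "b\<^sup>2 \<le> a * c"
proof (cases "c = 0")
  case True
  have "b = 0"
  proof (rule ccontr)
    assume "b \<noteq> 0"
    \<comment> \<open>With \<open>c = 0\<close> the polynomial is affine; this \<open>t\<close>
      solves \<open>a + 2 * t * b = - 1\<close>.\<close>
    then have "a + 2 * (- (a + 1) / (2 * b)) * b + (- (a + 1) / (2 * b))\<^sup>2 * c = - 1"
      using True by (simp add: field_simps)
    with nonneg[of "- (a + 1) / (2 * b)"] show False by simp
  qed
  with True show ?thesis by simp
next
  case False
  with c have "c > 0" by simp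
  \<comment> \<open>The point \<open>- b / c\<close> is the minimiser of the parabola.\<close>
  have "a + 2 * (- b / c) * b + (- b / c)\<^sup>2 * c = a - b\<^sup>2 / c"
    using False by (simp add: field_simps power2_eq_square)
  with nonneg[of "- b / c"] have "b\<^sup>2 / c \<le> a" by simp
  with \<open>c > 0\<close> show ?thesis by (simp add: field_simps)
qed

lemma symmetric_inner_matrix_vector:
  fixes A :: "real^'n^'n"
  assumes "transpose A = A"
  shows "x \<bullet> (A *v y) = y \<bullet> (A *v x)"
  by (metis assms dot_lmul_matrix inner_commute transpose_matrix_vector)

text \<open>\<open>lambda_max\<close> is a \<open>Max\<close>, so finiteness is needed to compute
  it. One eigenvector per eigenvalue gives an orthogonal family of nonzero vectors, which is
  independent and hence finite.\<close>

lemma finite_eigenvalues_symmetric: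
  fixes A :: "real^'n^'n"
  assumes "transpose A = A"
  shows "finite (eigenvalues A)"
proof -
  have "\<forall>l\<in>eigenvalues A. \<exists>w. w \<noteq> 0 \<and> A *v w = l *\<^sub>R w"
    by (simp add: eigenvalues_def)
  from bchoice[OF this]
  obtain f where f: "\<And>l. l \<in> eigenvalues A \<Longrightarrow> f l \<noteq> 0 \<and> A *v f l = l *\<^sub>R f l"
    by blast
  have inj: "inj_on f (eigenvalues A)"
    by (rule inj_onI) (metis f scaleR_right_imp_eq)
  have orth: "f l \<bullet> f k = 0" if "l \<in> eigenvalues A" "k \<in> eigenvalues A" "l \<noteq> k" for l k
  proof -
    have "k * (f l \<bullet> f k) = l * (f l \<bullet> f k)"
      using symmetric_inner_matrix_vector[OF assms, of "f l" "f k"] f[OF that(1)] f[OF that(2)]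
      by (simp add: inner_commute)
    with \<open>l \<noteq> k\<close> show ?thesis by simp
  qed
  have "pairwise orthogonal (f ` eigenvalues A)"
    using orth by (auto simp: pairwise_def orthogonal_def)
  moreover have "0 \<notin> f ` eigenvalues A" using f by auto
  ultimately have "independent (f ` eigenvalues A)"
    by (rule pairwise_orthogonal_independent)
  then have "finite (f ` eigenvalues A)"
    by (rule independent_imp_finite)
  then show ?thesis using inj finite_imageD by blast
qed

text \<open>A maximiser \<open>w\<close> of the Rayleigh quotient is an eigenvector: for the maximal value \<open>l\<close> the
  quadratic form of \<open>l I - A\<close> is nonnegative and vanishes at \<open>w\<close>, so by Cauchy--Schwarz
  \<open>(l I - A) w = 0\<close>.\<close>

lemma lambda_max_symmetric:
  fixes A :: "real^'n^'n"
  assumes sym: "transpose A = A"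
  shows "lambda_max A \<in> eigenvalues A" (is ?mem)
    and "w \<bullet> (A *v w) \<le> lambda_max A * (norm w)\<^sup>2" (is ?le)
proof -
  have "compact (sphere (0::real^'n) 1)" by simp
  moreover have "sphere (0::real^'n) 1 \<noteq> {}" by simp
  moreover have "continuous_on (sphere (0::real^'n) 1) (\<lambda>w. w \<bullet> (A *v w))"
    by (intro continuous_intros)
  ultimately obtain u where u: "norm u = 1"
    and umax: "\<And>w. norm w = 1 \<Longrightarrow> w \<bullet> (A *v w) \<le> u \<bullet> (A *v u)"
    using continuous_attains_sup[of "sphere (0::real^'n) 1" "\<lambda>w. w \<bullet> (A *v w)"] by auto
  define l where "l = u \<bullet> (A *v u)"
  have rayleigh: "w \<bullet> (A *v w) \<le> l * (norm w)\<^sup>2" for w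
  proof (cases "w = 0")
    case False
    have "(inverse (norm w) *\<^sub>R w) \<bullet> (A *v (inverse (norm w) *\<^sub>R w)) \<le> l"
      using False unfolding l_def by (intro umax) simp
    then show ?thesis
      using False by (simp add: matrix_vector_mult_scaleR field_simps power2_eq_square)
  qed simp
  define B where "B w = l *\<^sub>R w - A *v w" for w
  have Bsym: "x \<bullet> B y = y \<bullet> B x" for x y
    using symmetric_inner_matrix_vector[OF sym, of x y]
    by (simp add: B_def inner_diff_right inner_commute)
  have Bnonneg: "w \<bullet> B w \<ge> 0" for w
    using rayleigh[of w] by (simp add: B_def inner_diff_right power2_norm_eq_inner)
  have Bu: "u \<bullet> B u = 0"
    using u by (simp add: B_def inner_diff_right l_def power2_norm_eq_inner[symmetric])
  \<comment> \<open>By symmetry the left side is the square of \<open>B u \<bullet> B u\<close>,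
    while the first factor on the right vanishes.\<close>
  have "(u \<bullet> B (B u))\<^sup>2 \<le> (u \<bullet> B u) * (B u \<bullet> B (B u))"
  proof (rule discriminant_le)
    fix t
    have "B (u + t *\<^sub>R B u) = B u + t *\<^sub>R B (B u)"
      by (simp add: B_def algebra_simps matrix_vector_mult_scaleR)
    with Bnonneg[of "u + t *\<^sub>R B u"] Bsym[of u "B u"]
    show "u \<bullet> B u + 2 * t * (u \<bullet> B (B u)) + t\<^sup>2 * (B u \<bullet> B (B u)) \<ge> 0"
      by (simp add: inner_add_left inner_add_right power2_eq_square algebra_simps)
  qed (rule Bnonneg)
  then have "B u = 0"
    using Bu Bsym[of u "B u"] by simp
  then have l_mem: "l \<in> eigenvalues A"
    using u unfolding eigenvalues_def B_def by (auto intro!: exI[of _ u])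
  have "k \<le> l" if "k \<in> eigenvalues A" for k
  proof -
    from that obtain w where "w \<noteq> 0" "A *v w = k *\<^sub>R w" by (auto simp: eigenvalues_def)
    with rayleigh[of w] show ?thesis
      by (simp add: power2_norm_eq_inner)
  qed
  then have "lambda_max A = l"
    unfolding lambda_max_def
    using finite_eigenvalues_symmetric[OF sym] l_mem by (intro Max_eqI) auto
  with l_mem rayleigh show ?mem ?le by auto
qed

text \<open>Cauchy-Schwarz for the form of \<open>A\<close>, applied to \<open>w\<close> and
  \<open>A *v w\<close>, bounds the fourth power of \<open>norm (A *v w)\<close> and yields
  \<open>norm (A *v w) \<le> lambda_max A * norm w\<close>. A leading eigenvector gives the reverse
  bound. Semidefiniteness excludes a negative eigenvalue of larger modulus.\<close>

lemma spectral_norm_eq_lambda_max: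
  fixes A :: "real^'n^'n"
  assumes sym: "transpose A = A" and psd: "\<And>w. w \<bullet> (A *v w) \<ge> 0"
  shows "spectral_norm A = lambda_max A" and "lambda_max A \<ge> 0"
proof -
  let ?l = "lambda_max A"
  obtain u where u: "u \<noteq> 0" "A *v u = ?l *\<^sub>R u"
    using lambda_max_symmetric(1)[OF sym] by (auto simp: eigenvalues_def)
  show nonneg: "?l \<ge> 0"
    using psd[of u] u by (simp add: zero_le_mult_iff flip: power2_norm_eq_inner)
  have "norm (A *v w) \<le> ?l * norm w" for w
  proof -
    let ?v = "A *v w"
    have "(w \<bullet> (A *v ?v))\<^sup>2 \<le> (w \<bullet> (A *v w)) * (?v \<bullet> (A *v ?v))"
    proof (rule discriminant_le)
      fix t
      show "w \<bullet> (A *v w) + 2 * t * (w \<bullet> (A *v ?v)) + t\<^sup>2 * (?v \<bullet> (A *v ?v)) \<ge> 0"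
        using psd[of "w + t *\<^sub>R ?v"] symmetric_inner_matrix_vector[OF sym, of w ?v]
        by (simp add: matrix_vector_mult_scaleR matrix_vector_right_distrib
            inner_add_left inner_add_right power2_eq_square algebra_simps)
    qed (rule psd)
    also have "\<dots> \<le> (?l * (norm w)\<^sup>2) * (?l * (norm ?v)\<^sup>2)"
      using nonneg psd by (intro mult_mono lambda_max_symmetric(2)[OF sym]) auto
    finally have "(norm ?v * norm ?v)\<^sup>2 \<le> (?l * norm w * norm ?v)\<^sup>2"
      using symmetric_inner_matrix_vector[OF sym, of w ?v]
      by (simp add: power2_norm_eq_inner[symmetric] power2_eq_square algebra_simps)
    then have "norm ?v * norm ?v \<le> ?l * norm w * norm ?v"
      using nonneg by (simp add: power2_le_iff_abs_le)
    then show ?thesis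
      using nonneg by (cases "?v = 0") auto
  qed
  moreover have "?l \<le> onorm ((*v) A)"
    using le_onorm[of "(*v) A" u] u nonneg
    by (simp add: matrix_vector_mul_bounded_linear)
  ultimately show "spectral_norm A = ?l"
    unfolding spectral_norm_def by (intro antisym onorm_le) auto
qed


section \<open>Hilbert spaces of functions\<close>

locale hilbert_functions =
  fixes D :: "'a set" and H :: "('a \<Rightarrow> 'b::real_vector) set" and ip
  assumes hilbert: "hilbert_function_space D H ip"
begin

lemma zero_mem: "(\<lambda>y. 0) \<in> H"
  and add_mem: "u \<in> H \<Longrightarrow> v \<in> H \<Longrightarrow> (\<lambda>y. u y + v y) \<in> H"
  and scale_mem: "u \<in> H \<Longrightarrow> (\<lambda>y. c *\<^sub>R u y) \<in> H"
  and ip_commute: "u \<in> H \<Longrightarrow> v \<in> H \<Longrightarrow> ip u v = ip v u"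
  and ip_add_left: "u \<in> H \<Longrightarrow> v \<in> H \<Longrightarrow> w \<in> H \<Longrightarrow> ip (\<lambda>y. u y + v y) w = ip u w + ip v w"
  and ip_scale_left: "u \<in> H \<Longrightarrow> w \<in> H \<Longrightarrow> ip (\<lambda>y. c *\<^sub>R u y) w = c * ip u w"
  and ip_pos: "u \<in> H \<Longrightarrow> u \<noteq> (\<lambda>y. 0) \<Longrightarrow> ip u u > 0"
  using hilbert unfolding hilbert_function_space_def by blast+

lemma diff_mem: "u \<in> H \<Longrightarrow> v \<in> H \<Longrightarrow> (\<lambda>y. u y - v y) \<in> H"
  using add_mem[OF _ scale_mem[of v "- 1"], of u] by simp

lemma ip_diff_left: "u \<in> H \<Longrightarrow> v \<in> H \<Longrightarrow> w \<in> H \<Longrightarrow> ip (\<lambda>y. u y - v y) w = ip u w - ip v w"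
  using ip_add_left[OF _ scale_mem[of v "- 1"], of u w] ip_scale_left[of v w "- 1"] by simp

lemma ip_add_right: "u \<in> H \<Longrightarrow> v \<in> H \<Longrightarrow> w \<in> H \<Longrightarrow> ip w (\<lambda>y. u y + v y) = ip w u + ip w v"
  by (simp add: ip_commute[of w] ip_add_left add_mem)

lemma ip_scale_right: "u \<in> H \<Longrightarrow> w \<in> H \<Longrightarrow> ip w (\<lambda>y. c *\<^sub>R u y) = c * ip w u"
  by (simp add: ip_commute[of w] ip_scale_left scale_mem)

lemma ip_diff_right: "u \<in> H \<Longrightarrow> v \<in> H \<Longrightarrow> w \<in> H \<Longrightarrow> ip w (\<lambda>y. u y - v y) = ip w u - ip w v"
  by (simp add: ip_commute[of w] ip_diff_left diff_mem)

lemma ip_zero_left: "u \<in> H \<Longrightarrow> ip (\<lambda>y. 0) u = 0"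
  using ip_scale_left[of u u 0] by simp

lemma ip_self_nonneg: "u \<in> H \<Longrightarrow> ip u u \<ge> 0"
  by (cases "u = (\<lambda>y. 0)") (auto simp: ip_zero_left dest: ip_pos)

lemma sum_mem:
  assumes "\<And>j. j \<in> S \<Longrightarrow> f j \<in> H"
  shows "(\<lambda>y. \<Sum>j\<in>S. f j y) \<in> H"
  using assms by (induction S rule: infinite_finite_induct) (auto intro: zero_mem add_mem)

lemma ip_sum_right:
  assumes "\<And>j. j \<in> S \<Longrightarrow> f j \<in> H" "u \<in> H"
  shows "ip u (\<lambda>y. \<Sum>j\<in>S. f j y) = (\<Sum>j\<in>S. ip u (f j))"
  using assms
  by (induction S rule: infinite_finite_induct)
    (auto simp: ip_add_right sum_mem ip_commute[OF _ zero_mem] ip_zero_left)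

lemma ip_cauchy_schwarz:
  assumes "u \<in> H" "v \<in> H"
  shows "(ip u v)\<^sup>2 \<le> ip u u * ip v v"
proof (rule discriminant_le)
  fix t
  have "0 \<le> ip (\<lambda>y. u y + t *\<^sub>R v y) (\<lambda>y. u y + t *\<^sub>R v y)"
    using assms by (intro ip_self_nonneg add_mem scale_mem)
  also have "\<dots> = ip u u + 2 * t * ip u v + t\<^sup>2 * ip v v"
    using assms ip_commute[of u v]
    by (simp add: ip_add_left ip_add_right ip_scale_left ip_scale_right add_mem scale_mem
        power2_eq_square algebra_simps)
  finally show "0 \<le> ip u u + 2 * t * ip u v + t\<^sup>2 * ip v v" .
qed (intro ip_self_nonneg assms)

lemma ip_norm_normalized:
  assumes "u \<in> H" and pos: "ip u u > 0"
  shows "ip_norm ip (\<lambda>y. inverse (sqrt (ip u u)) *\<^sub>R u y) = 1"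
proof -
  have "inverse (sqrt (ip u u)) * (inverse (sqrt (ip u u)) * ip u u) = 1"
    using pos by (simp add: field_simps)
  then show ?thesis
    using assms by (simp add: ip_norm_def ip_scale_left ip_scale_right scale_mem)
qed

end


section \<open>Kernel interpolation\<close>

definition unblock :: "real^('p \<times> 'n) \<Rightarrow> 'p::finite \<Rightarrow> real^'n" where
  "unblock c j = (\<chi> b. c $ (j, b))"

lemma block_vec_unblock [simp]: "block_vec (unblock c) = c"
  by (simp add: block_vec_def unblock_def vec_eq_iff)

lemma unblock_block_vec [simp]: "unblock (block_vec Y) = Y"
  by (simp add: block_vec_def unblock_def vec_eq_iff fun_eq_iff)

lemma invertible_matrix_inv:
  assumes "invertible A"
  shows "A ** matrix_inv A = mat 1" and "matrix_inv A ** A = mat 1"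
  using someI_ex[OF assms[unfolded invertible_def]] by (simp_all add: matrix_inv_def)

lemma kernel_row_mult:
  "kernel_row K X x *v c = (\<Sum>j\<in>UNIV. K x (X j) *v unblock c j)"
  \<comment> \<open>The double sum over blocks and positions is merged into a sum over pairs;
    writing the universe of pairs as a product makes both sides match.\<close>
  by (simp add: vec_eq_iff matrix_vector_mult_def kernel_row_def unblock_def sum_component
      sum.cartesian_product split_def UNIV_Times_UNIV[symmetric] del: UNIV_Times_UNIV)

lemma kernel_matrix_mult:
  "kernel_matrix K X *v c = block_vec (\<lambda>i. kernel_row K X (X i) *v c)"
  by (simp add: vec_eq_iff matrix_vector_mult_def kernel_row_def kernel_matrix_def block_vec_def)

lemma inner_block_vec: "c \<bullet> block_vec Y = (\<Sum>i\<in>UNIV. unblock c i \<bullet> Y i)"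
  by (simp add: inner_vec_def block_vec_def unblock_def
      sum.cartesian_product split_def UNIV_Times_UNIV[symmetric] del: UNIV_Times_UNIV)

text \<open>Positive definiteness is stated for points numbered below \<open>N\<close>; a bijection
  from \<open>{..<CARD('p)}\<close> carries it over to families over \<open>'p\<close>.\<close>

lemma pd_kernel_family:
  fixes X :: "'p::finite \<Rightarrow> real^'d" and w :: "'p \<Rightarrow> real^'n"
  assumes pd: "pd_kernel D K" and "range X \<subseteq> D" "inj X" and "w i0 \<noteq> 0"
  shows "(\<Sum>i\<in>UNIV. \<Sum>j\<in>UNIV. w i \<bullet> (K (X i) (X j) *v w j)) > 0"
proof -
  obtain f where f: "bij_betw f {..<CARD('p)} (UNIV :: 'p set)"
    using ex_bij_betw_nat_finite[of "UNIV :: 'p set"] by (auto simp: atLeast0LessThan)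
  have "(X \<circ> f) ` {..<CARD('p)} \<subseteq> D" using assms(2) by auto
  moreover have "inj_on (X \<circ> f) {..<CARD('p)}"
    using f \<open>inj X\<close> by (intro comp_inj_on) (auto simp: bij_betw_def inj_on_def)
  moreover have "\<exists>i<CARD('p). (w \<circ> f) i \<noteq> 0"
  proof -
    have "i0 \<in> f ` {..<CARD('p)}" using f by (auto simp: bij_betw_def)
    with \<open>w i0 \<noteq> 0\<close> show ?thesis by auto
  qed
  ultimately have "(\<Sum>i<CARD('p). \<Sum>j<CARD('p).
      (w \<circ> f) i \<bullet> (K ((X \<circ> f) i) ((X \<circ> f) j) *v (w \<circ> f) j)) > 0"
    using pd unfolding pd_kernel_def by blast
  also have "(\<Sum>i<CARD('p). \<Sum>j<CARD('p). (w \<circ> f) i \<bullet> (K ((X \<circ> f) i) ((X \<circ> f) j) *v (w \<circ> f) j)) =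
      (\<Sum>i<CARD('p). \<Sum>j\<in>UNIV. w (f i) \<bullet> (K (X (f i)) (X j) *v w j))"
    by (intro sum.cong refl) (simp add: sum.reindex_bij_betw[OF f, symmetric])
  also have "\<dots> = (\<Sum>i\<in>UNIV. \<Sum>j\<in>UNIV. w i \<bullet> (K (X i) (X j) *v w j))"
    by (rule sum.reindex_bij_betw[OF f])
  finally show ?thesis .
qed

section \<open>Unique solvability and the matrix form of interpolation\<close>

locale kernel_interpolation =
  fixes D :: "(real^'d) set"
    and K :: "real^'d \<Rightarrow> real^'d \<Rightarrow> real^'n^'n"
    and X :: "'p::finite \<Rightarrow> real^'d"
  assumes pd: "pd_kernel D K" and range_X: "range X \<subseteq> D" and inj_X: "inj X"
begin

lemma X_mem [simp]: "X i \<in> D"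
  using range_X by auto

text \<open>The quadratic form of the kernel matrix is the double sum in the definition of positive
  definiteness, so no nonzero vector lies in the null space.\<close>

lemma invertible_kernel_matrix: "invertible (kernel_matrix K X)"
proof -
  have "c = 0" if c: "kernel_matrix K X *v c = 0" for c
  proof (rule ccontr)
    assume "c \<noteq> 0"
    then obtain i b where "c $ (i, b) \<noteq> 0"
      by (auto simp: vec_eq_iff)
    then have "unblock c i \<noteq> 0"
      by (auto simp: unblock_def vec_eq_iff)
    then have "(\<Sum>i\<in>UNIV. \<Sum>j\<in>UNIV. unblock c i \<bullet> (K (X i) (X j) *v unblock c j)) > 0"
      by (rule pd_kernel_family[OF pd range_X inj_X])
    also have "\<dots> = c \<bullet> (kernel_matrix K X *v c)"
      by (simp add: kernel_matrix_mult inner_block_vec kernel_row_mult inner_sum_right)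
    finally show False using c by simp
  qed
  then show ?thesis
    by (simp add: invertible_left_inverse matrix_left_invertible_ker)
qed

lemma kernel_matrix_mult_eq_iff:
  "kernel_matrix K X *v c = d \<longleftrightarrow> c = matrix_inv (kernel_matrix K X) *v d"
  by (metis invertible_kernel_matrix invertible_matrix_inv matrix_vector_mul_assoc
      matrix_vector_mul_lid)

text \<open>An explicit solution to stand for the \<open>THE\<close> in \<open>interp\<close>; it is
  extended by zero so that it lies in \<open>kernel_span\<close>.\<close>

definition interpolant :: "('p \<Rightarrow> real^'n) \<Rightarrow> real^'d \<Rightarrow> real^'n" where
  "interpolant Y =
     fun_on D (\<lambda>y. kernel_row K X y *v (matrix_inv (kernel_matrix K X) *v block_vec Y))"

lemma kernel_span_alt: "kernel_span D K X = range (\<lambda>c. fun_on D (\<lambda>y. kernel_row K X y *v c))"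
proof -
  have "surj (block_vec :: ('p \<Rightarrow> real^'n) \<Rightarrow> _)"
    by (rule surjI[of _ unblock]) simp
  then have "range (\<lambda>c. fun_on D (\<lambda>y. kernel_row K X y *v c)) =
      range (\<lambda>\<beta>. fun_on D (\<lambda>y. kernel_row K X y *v block_vec \<beta>))"
    using image_image[of "\<lambda>c. fun_on D (\<lambda>y. kernel_row K X y *v c)" block_vec UNIV] by simp
  then show ?thesis
    by (simp add: kernel_span_def kernel_row_mult full_SetCompr_eq)
qed

text \<open>For block coefficients \<open>c\<close>, the interpolation conditions are the system
  \<open>kernel_matrix K X *v c = block_vec Y\<close>, which has exactly one solution. The
  equivalence delivers existence and uniqueness together.\<close>

lemma interpolant_unique:
  "s \<in> kernel_span D K X \<and> (\<forall>i. s (X i) = Y i) \<longleftrightarrow> s = interpolant Y"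
proof -
  have "(\<forall>i. fun_on D (\<lambda>y. kernel_row K X y *v c) (X i) = Y i) \<longleftrightarrow>
      c = matrix_inv (kernel_matrix K X) *v block_vec Y" for c
  proof -
    have "(\<forall>i. fun_on D (\<lambda>y. kernel_row K X y *v c) (X i) = Y i) \<longleftrightarrow>
        kernel_matrix K X *v c = block_vec Y"
      unfolding kernel_matrix_mult
      by (simp add: fun_on_def vec_eq_iff block_vec_def)
    then show ?thesis by (simp add: kernel_matrix_mult_eq_iff)
  qed
  then show ?thesis
    unfolding kernel_span_alt interpolant_def by auto
qed

lemma interp_eq_interpolant: "interp D K X Y = interpolant Y"
  unfolding interp_def by (simp add: interpolant_unique)

lemma interp_mem: "interp D K X Y \<in> kernel_span D K X"
  and interp_at: "interp D K X Y (X i) = Y i"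
  using interpolant_unique[of "interpolant Y" Y] by (auto simp: interp_eq_interpolant)

lemma interp_apply:
  "x \<in> D \<Longrightarrow>
    interp D K X Y x = (kernel_row K X x ** matrix_inv (kernel_matrix K X)) *v block_vec Y"
  by (simp add: interp_eq_interpolant interpolant_def fun_on_def matrix_vector_mul_assoc)

lemma interp_zero [simp]: "interp D K X (\<lambda>i. 0) = (\<lambda>y. 0)"
proof -
  have "block_vec (\<lambda>i::'p. 0 :: real^'n) = 0"
    by (simp add: block_vec_def vec_eq_iff)
  then show ?thesis
    by (simp add: interp_eq_interpolant interpolant_def fun_on_def fun_eq_iff)
qed

lemma predictive_mean_eq_interp:
  assumes "x \<in> D"
  shows "predictive_mean K X m (\<lambda>j. v (X j)) x =
    m x + interp_fun D K X v x - interp_fun D K X m x"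
  using assms
  by (simp add: predictive_mean_def interp_fun_def interp_apply matrix_vector_mult_diff_distrib)

lemma kernel_transpose:
  assumes "x \<in> D" "x' \<in> D"
  shows "K x x' $ a $ b = K x' x $ b $ a"
proof -
  have "transpose (K x' x) = K x x'"
    using pd assms unfolding pd_kernel_def by blast
  then have "transpose (K x' x) $ a $ b = K x x' $ a $ b" by simp
  then show ?thesis by (simp add: transpose_def)
qed

text \<open>At a fixed point, interpolation multiplies the stacked data from the left by one matrix,
  which commutes with multiplication by \<open>w\<close> from the right.\<close>

lemma interp_columns_mult:
  assumes "x \<in> D"
  shows "interp_columns D K X F x *v w = interp_fun D K X (\<lambda>z. F z *v w) x"
proof -
  let ?R = "kernel_row K X x ** matrix_inv (kernel_matrix K X)"
  let ?C = "(\<chi> p c. F (X (fst p)) $ snd p $ c) :: real^'n^('p \<times> 'n)"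
  have "interp_columns D K X F x = ?R ** ?C"
    using assms
    by (simp add: interp_columns_def interp_fun_def interp_apply vec_eq_iff block_vec_def
        column_def matrix_vector_mult_def matrix_matrix_mult_def[of ?R])
  moreover have "?C *v w = block_vec (\<lambda>i. F (X i) *v w)"
    by (simp add: vec_eq_iff block_vec_def matrix_vector_mult_def)
  ultimately show ?thesis
    using assms by (simp add: interp_fun_def interp_apply matrix_vector_mul_assoc[symmetric])
qed

text \<open>By symmetry of the kernel, the transposed row at \<open>x'\<close> stacks the matrices
  \<open>K (X i) x'\<close>, which are the interpolation data of
  \<open>\<lambda>z. K z x'\<close>.\<close>

lemma predictive_cov_eq_interp:
  assumes "x \<in> D" "x' \<in> D"
  shows "predictive_cov K X x x' = K x x' - interp_columns D K X (\<lambda>z. K z x') x"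
proof -
  let ?R = "kernel_row K X x ** matrix_inv (kernel_matrix K X)"
  \<comment> \<open>Naming the product keeps the simplifier from expanding its entries.\<close>
  obtain R where R: "?R = R" by simp
  have "interp_columns D K X (\<lambda>z. K z x') x = R ** transpose (kernel_row K X x')"
    using assms kernel_transpose[OF \<open>x' \<in> D\<close> X_mem]
    by (simp add: interp_columns_def interp_fun_def interp_apply R vec_eq_iff
        block_vec_def column_def matrix_vector_mult_def matrix_matrix_mult_def[of R] transpose_def
        kernel_row_def[of K X x'])
  then show ?thesis by (simp add: predictive_cov_def R)
qed

end


section \<open>The reproducing kernel Hilbert space\<close>

locale rkhs_interpolation = kernel_interpolation D K X
  for D :: "(real^'d) set"
    and K :: "real^'d \<Rightarrow> real^'d \<Rightarrow> real^'n^'n"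
    and X :: "'p::finite \<Rightarrow> real^'d" +
  fixes H ip
  assumes rkhs: "is_rkhs D K H ip"
begin

sublocale hilbert_functions D H ip
  using rkhs by unfold_locales (simp add: is_rkhs_def)

text \<open>The Riesz representer in \<open>H\<close> of the functional
  \<open>\<lambda>v. v x \<bullet> w\<close>.\<close>

definition section_at :: "real^'d \<Rightarrow> real^'n \<Rightarrow> real^'d \<Rightarrow> real^'n" where
  "section_at x w = fun_on D (\<lambda>y. K y x *v w)"

lemma section_at_mem: "x \<in> D \<Longrightarrow> section_at x w \<in> H"
  and reproducing: "v \<in> H \<Longrightarrow> x \<in> D \<Longrightarrow> ip v (section_at x w) = v x \<bullet> w"
  using rkhs by (auto simp: is_rkhs_def section_at_def)

lemma kernel_span_cases:
  assumes "s \<in> kernel_span D K X"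
  obtains \<beta> where "s = (\<lambda>y. \<Sum>j\<in>UNIV. section_at (X j) (\<beta> j) y)"
proof -
  from assms obtain \<beta> where "s = fun_on D (\<lambda>y. \<Sum>j\<in>UNIV. K y (X j) *v \<beta> j)"
    by (auto simp: kernel_span_def)
  then show thesis
    by (intro that[of \<beta>]) (simp add: section_at_def fun_on_def fun_eq_iff)
qed

lemma kernel_span_subset: "s \<in> kernel_span D K X \<Longrightarrow> s \<in> H"
  by (erule kernel_span_cases) (auto intro!: sum_mem section_at_mem)

lemma interp_mem_H: "interp D K X Y \<in> H"
  by (simp add: interp_mem kernel_span_subset)

section \<open>Orthogonality and the minimal norm property\<close>

lemma orthogonal_kernel_span:
  assumes "v \<in> H" "\<And>i. v (X i) = 0" "s \<in> kernel_span D K X"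
  shows "ip v s = 0"
  using assms(3)
proof (cases rule: kernel_span_cases)
  case (1 \<beta>)
  then show ?thesis
    using assms by (simp add: ip_sum_right section_at_mem reproducing)
qed

text \<open>The difference \<open>d\<close> vanishes at the nodes and is therefore orthogonal to the
  interpolant, so the mixed terms drop out.\<close>

lemma pythagoras:
  assumes "s \<in> H" "\<And>i. s (X i) = Y i"
  defines "d \<equiv> \<lambda>y. s y - interp D K X Y y"
  shows "ip s s = ip (interp D K X Y) (interp D K X Y) + ip d d"
proof -
  let ?g = "interp D K X Y"
  have d: "d \<in> H" unfolding d_def by (intro diff_mem assms interp_mem_H)
  have "ip d ?g = 0"
    by (intro orthogonal_kernel_span d interp_mem) (simp add: d_def assms(2) interp_at)
  moreover have "s = (\<lambda>y. ?g y + d y)" by (simp add: d_def)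
  ultimately show ?thesis
    using d interp_mem_H[of Y] ip_commute[of d ?g]
    by (simp add: ip_add_left ip_add_right add_mem)
qed

lemma is_arg_min_iff_interp:
  "is_arg_min (ip_norm ip) (\<lambda>s. s \<in> H \<and> (\<forall>i. s (X i) = Y i)) s \<longleftrightarrow> s = interp D K X Y"
proof -
  let ?g = "interp D K X Y"
  have le: "ip_norm ip ?g \<le> ip_norm ip u" if "u \<in> H" "\<forall>i. u (X i) = Y i" for u
    using pythagoras[of u Y] ip_self_nonneg[OF diff_mem[OF that(1) interp_mem_H[of Y]]] that
    by (simp add: ip_norm_def)
  have "s = ?g" if s: "s \<in> H" "\<forall>i. s (X i) = Y i" and "\<not> ip_norm ip ?g < ip_norm ip s"
  proof -
    \<comment> \<open>If \<open>s\<close> is no longer than \<open>?g\<close>, the Pythagorean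
      identity leaves no room for the difference, and definiteness makes it zero.\<close>
    have "ip (\<lambda>y. s y - ?g y) (\<lambda>y. s y - ?g y) \<le> 0"
      using pythagoras[of s Y] that by (simp add: ip_norm_def)
    then have "(\<lambda>y. s y - ?g y) = (\<lambda>y. 0)"
      using ip_pos[OF diff_mem[OF s(1) interp_mem_H[of Y]]] by fastforce
    then show ?thesis by (simp add: fun_eq_iff)
  qed
  moreover have "?g \<in> H \<and> (\<forall>i. ?g (X i) = Y i)"
    by (simp add: interp_mem_H interp_at)
  ultimately show ?thesis
    using le unfolding is_arg_min_def by (metis not_less)
qed

section \<open>Residuals of kernel sections and the predictive variance\<close>

definition residual :: "real^'d \<Rightarrow> real^'n \<Rightarrow> real^'d \<Rightarrow> real^'n" where
  "residual x w = (\<lambda>y. section_at x w y - interp_fun D K X (section_at x w) y)"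

lemma residual_mem: "x \<in> D \<Longrightarrow> residual x w \<in> H"
  unfolding residual_def interp_fun_def by (intro diff_mem section_at_mem interp_mem_H)

lemma residual_at: "residual x w (X i) = 0"
  by (simp add: residual_def interp_fun_def interp_at)

text \<open>An orthogonal projection is self-adjoint and idempotent: the pairing of \<open>v\<close>
  with the residual of \<open>?s\<close> equals that of \<open>?d\<close> with the residual, and
  then that of \<open>?d\<close> with \<open>?s\<close>, where the reproducing property
  applies.\<close>

lemma ip_residual:
  assumes "v \<in> H" "x \<in> D"
  shows "ip v (residual x w) = (v x - interp_fun D K X v x) \<bullet> w"
proof -
  let ?s = "section_at x w"
  let ?d = "\<lambda>y. v y - interp_fun D K X v y"
  have I: "interp_fun D K X u \<in> H" "interp_fun D K X u \<in> kernel_span D K X"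
    "interp_fun D K X u (X i) = u (X i)" for u i
    by (simp_all add: interp_fun_def interp_mem_H interp_mem interp_at)
  have d: "?d \<in> H" using assms I by (intro diff_mem)
  have "ip (residual x w) (interp_fun D K X v) = 0"
    by (intro orthogonal_kernel_span residual_mem residual_at I assms)
  then have "ip v (residual x w) = ip ?d (residual x w)"
    using assms I residual_mem[of x w] by (simp add: ip_diff_left ip_commute)
  also have "\<dots> = ip ?d ?s - ip ?d (interp_fun D K X ?s)"
    unfolding residual_def using d assms I by (intro ip_diff_right section_at_mem) auto
  also have "ip ?d (interp_fun D K X ?s) = 0"
    using d by (intro orthogonal_kernel_span) (simp_all add: I)
  finally show ?thesis
    using reproducing[OF d] assms by simp
qed

lemma residual_eq_predictive_cov:
  assumes "x \<in> D" "x' \<in> D"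
  shows "residual x' w x = predictive_cov K X x x' *v w"
proof -
  \<comment> \<open>The two functions agree at the nodes, which lie in \<open>D\<close>, so they
    have the same interpolant.\<close>
  have "interp_fun D K X (section_at x' w) = interp_fun D K X (\<lambda>z. K z x' *v w)"
    by (simp add: interp_fun_def section_at_def fun_on_def)
  then show ?thesis
    using assms
    by (simp add: residual_def predictive_cov_eq_interp interp_columns_mult
        matrix_vector_mult_diff_rdistrib)
      (simp add: section_at_def fun_on_def)
qed

text \<open>A residual vanishes at the nodes, so its own interpolant is zero and
  \<open>ip_residual\<close> leaves only its value at \<open>x\<close>.\<close>

lemma ip_residual_residual:
  assumes "x \<in> D" "x' \<in> D"
  shows "ip (residual x' w) (residual x u) = u \<bullet> (predictive_cov K X x x' *v w)"
proof -
  have "interp_fun D K X (residual x' w) x = 0"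
    by (simp add: interp_fun_def residual_at)
  then show ?thesis
    using assms
    by (simp add: ip_residual residual_mem residual_eq_predictive_cov inner_commute)
qed

text \<open>The covariance is a Gram matrix of residuals, so its symmetry is that of
  \<open>ip\<close>.\<close>

lemma transpose_predictive_cov:
  assumes "x \<in> D" "x' \<in> D"
  shows "transpose (predictive_cov K X x' x) = predictive_cov K X x x'"
proof -
  have "u \<bullet> (predictive_cov K X x x' *v w) = u \<bullet> (transpose (predictive_cov K X x' x) *v w)" for u w
  proof -
    have "u \<bullet> (predictive_cov K X x x' *v w) = w \<bullet> (predictive_cov K X x' x *v u)"
      using assms ip_commute[OF residual_mem residual_mem]
      by (simp add: ip_residual_residual[symmetric])
    also have "\<dots> = u \<bullet> (transpose (predictive_cov K X x' x) *v w)"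
      using dot_lmul_matrix[of w "predictive_cov K X x' x" u]
      by (simp add: transpose_matrix_vector inner_commute)
    finally show ?thesis .
  qed
  then have "predictive_cov K X x x' *v w = transpose (predictive_cov K X x' x) *v w" for w
    using vector_eq_ldot by blast
  then show ?thesis by (simp add: matrix_eq)
qed

text \<open>Needed for the supremum of reals to be bounded by a common upper bound. The witness is
  the normalised interpolant of the all-ones data, nonzero at every node.\<close>

lemma sphere_nonempty: "{v \<in> H. ip_norm ip v = 1} \<noteq> {}"
proof -
  let ?s = "interp D K X (\<lambda>i. 1)"
  have "?s \<noteq> (\<lambda>y. 0)"
    using interp_at[of "\<lambda>i. 1" undefined] by auto
  then have "ip ?s ?s > 0" by (intro ip_pos interp_mem_H)
  then show ?thesis
    using ip_norm_normalized[OF interp_mem_H] scale_mem[OF interp_mem_H] by blast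
qed

lemma power_function:
  assumes x: "x \<in> D"
  defines "E \<equiv> \<lambda>v. v x - interp_fun D K X v x"
    and "S \<equiv> predictive_cov K X x x"
  shows "spectral_norm S = lambda_max S"
    and "bdd_above ((\<lambda>v. (norm (E v))\<^sup>2) ` {v \<in> H. ip_norm ip v = 1})"
    and "lambda_max S = (SUP v\<in>{v \<in> H. ip_norm ip v = 1}. (norm (E v))\<^sup>2)"
proof -
  have sym: "transpose S = S"
    unfolding S_def using x x by (rule transpose_predictive_cov)
  have form: "w \<bullet> (S *v w) = ip (residual x w) (residual x w)" for w
    unfolding S_def using x by (simp add: ip_residual_residual)
  have psd: "w \<bullet> (S *v w) \<ge> 0" for w
    unfolding form using x by (intro ip_self_nonneg residual_mem)
  let ?l = "lambda_max S"
  show "spectral_norm S = ?l"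
    using sym psd by (rule spectral_norm_eq_lambda_max)
  have nonneg: "?l \<ge> 0"
    using sym psd by (rule spectral_norm_eq_lambda_max)
  let ?B = "{v \<in> H. ip_norm ip v = 1}"
  have bound: "(norm (E v))\<^sup>2 \<le> ?l" if "v \<in> ?B" for v
  proof -
    from that have v: "v \<in> H" "ip v v = 1" by (auto simp: ip_norm_def)
    \<comment> \<open>Testing with the error vector itself, \<open>w = E v\<close>, turns the
      pairing into its squared norm.\<close>
    have "((norm (E v))\<^sup>2)\<^sup>2 = (ip v (residual x (E v)))\<^sup>2"
      using v x by (simp add: ip_residual E_def power2_norm_eq_inner)
    also have "\<dots> \<le> E v \<bullet> (S *v E v)"
      using ip_cauchy_schwarz[OF v(1) residual_mem[OF x]] v form by simp
    also have "\<dots> \<le> ?l * (norm (E v))\<^sup>2"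
      by (rule lambda_max_symmetric(2)[OF sym])
    finally have "(norm (E v))\<^sup>2 * (norm (E v))\<^sup>2 \<le> ?l * (norm (E v))\<^sup>2"
      by (simp add: power2_eq_square)
    then show ?thesis
      using nonneg mult_right_le_imp_le[of "(norm (E v))\<^sup>2" "(norm (E v))\<^sup>2" ?l]
      by (cases "E v = 0") auto
  qed
  then show bdd: "bdd_above ((\<lambda>v. (norm (E v))\<^sup>2) ` ?B)"
    by (auto intro!: bdd_aboveI)
  have attained: "\<exists>v\<in>?B. ?l \<le> (norm (E v))\<^sup>2"
  proof (cases "?l = 0")
    \<comment> \<open>The residual of a leading eigenvector is now zero and cannot be normalised,
      but any unit vector of \<open>H\<close> will do.\<close>
    case True
    then show ?thesis using sphere_nonempty by auto
  next
    case False
    with nonneg have pos: "?l > 0" by simp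
    obtain u where u: "u \<noteq> 0" "S *v u = ?l *\<^sub>R u"
      using lambda_max_symmetric(1)[OF sym] by (auto simp: eigenvalues_def)
    define w where "w = inverse (norm u) *\<^sub>R u"
    have w: "norm w = 1" "S *v w = ?l *\<^sub>R w"
      using u by (auto simp: w_def matrix_vector_mult_scaleR)
    let ?r = "residual x w"
    have r: "?r \<in> H" using x by (rule residual_mem)
    have rr: "ip ?r ?r = ?l"
      unfolding form[symmetric] using w by (simp add: power2_norm_eq_inner[symmetric])
    \<comment> \<open>The residual has squared norm \<open>?l\<close>, so this scaling puts it on
      the unit sphere.\<close>
    define v where "v = (\<lambda>y. inverse (sqrt ?l) *\<^sub>R ?r y)"
    have v: "v \<in> H" unfolding v_def using r by (rule scale_mem)
    have "v \<in> ?B"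
      using v ip_norm_normalized[OF r] rr pos by (simp add: v_def)
    moreover have "ip v ?r = sqrt ?l"
      unfolding v_def using r rr pos by (simp add: ip_scale_left field_simps)
    then have "sqrt ?l = E v \<bullet> w"
      using v x by (simp add: ip_residual E_def)
    then have "sqrt ?l \<le> norm (E v)"
      using norm_cauchy_schwarz[of "E v" w] w by simp
    then have "(sqrt ?l)\<^sup>2 \<le> (norm (E v))\<^sup>2"
      using nonneg by (intro power_mono) auto
    then have "?l \<le> (norm (E v))\<^sup>2" using nonneg by simp
    ultimately show ?thesis by blast
  qed
  show "?l = (SUP v\<in>?B. (norm (E v))\<^sup>2)"
  proof (rule antisym)
    obtain v where "v \<in> ?B" "?l \<le> (norm (E v))\<^sup>2" using attained by blast
    then show "?l \<le> (SUP v\<in>?B. (norm (E v))\<^sup>2)"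
      using bdd by (intro cSUP_upper2)
    show "(SUP v\<in>?B. (norm (E v))\<^sup>2) \<le> ?l"
      using sphere_nonempty bound by (rule cSUP_least)
  qed
qed

end

theorem theorem3p10:
  fixes D :: "(real^'d) set"
    and K :: "real^'d \<Rightarrow> real^'d \<Rightarrow> real^'n^'n"
    and X :: "'p::finite \<Rightarrow> real^'d"
    and H :: "(real^'d \<Rightarrow> real^'n) set"
    and ip :: "(real^'d \<Rightarrow> real^'n) \<Rightarrow> (real^'d \<Rightarrow> real^'n) \<Rightarrow> real"
  assumes "pd_kernel D K"
    and "range X \<subseteq> D"
    and "inj X"
    and "is_rkhs D K H ip"
  shows
    "((\<forall>Y :: 'p \<Rightarrow> real^'n. \<exists>!s. s \<in> kernel_span D K X \<and> (\<forall>i. s (X i) = Y i)) \<and>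
      (\<forall>v :: real^'d \<Rightarrow> real^'n. continuous_on D v \<longrightarrow>
         interp_fun D K X v \<in> kernel_span D K X \<and> (\<forall>i. interp_fun D K X v (X i) = v (X i)))) \<and>
     (\<forall>(Y :: 'p \<Rightarrow> real^'n) s.
        is_arg_min (ip_norm ip) (\<lambda>s. s \<in> H \<and> (\<forall>i. s (X i) = Y i)) s \<longleftrightarrow> s = interp D K X Y) \<and>
     (\<forall>(v :: real^'d \<Rightarrow> real^'n) m. continuous_on D v \<longrightarrow> continuous_on D m \<longrightarrow>
        (\<forall>x\<in>D. predictive_mean K X m (\<lambda>j. v (X j)) x =
                 m x + interp_fun D K X v x - interp_fun D K X m x)) \<and>
     (\<forall>x\<in>D. \<forall>x'\<in>D.
        predictive_cov K X x x' = K x x' - interp_columns D K X (\<lambda>z. K z x') x \<and>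
        predictive_cov K X x x' = K x x' - transpose (interp_columns D K X (\<lambda>z. K z x) x')) \<and>
     (\<forall>x\<in>D.
        spectral_norm (predictive_cov K X x x) = lambda_max (predictive_cov K X x x) \<and>
        bdd_above ((\<lambda>v. (norm (v x - interp_fun D K X v x))\<^sup>2) ` {v \<in> H. ip_norm ip v = 1}) \<and>
        lambda_max (predictive_cov K X x x) =
          (SUP v\<in>{v \<in> H. ip_norm ip v = 1}. (norm (v x - interp_fun D K X v x))\<^sup>2))"
proof -
  interpret rkhs_interpolation D K X H ip
    using assms by unfold_locales
  show ?thesis
  proof (intro conjI allI impI ballI)
    fix Y :: "'p \<Rightarrow> real^'n"
    show "\<exists>!s. s \<in> kernel_span D K X \<and> (\<forall>i. s (X i) = Y i)"
      by (simp add: interpolant_unique)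
  next
    fix x x' assume "x \<in> D" "x' \<in> D"
    then show "predictive_cov K X x x' = K x x' - interp_columns D K X (\<lambda>z. K z x') x"
      by (rule predictive_cov_eq_interp)
    \<comment> \<open>The second formula is the first one with \<open>x\<close> and
      \<open>x'\<close> exchanged, then transposed.\<close>
    have "predictive_cov K X x x' = transpose (K x' x - interp_columns D K X (\<lambda>z. K z x) x')"
      using \<open>x \<in> D\<close> \<open>x' \<in> D\<close>
      by (simp add: transpose_predictive_cov flip: predictive_cov_eq_interp)
    then show "predictive_cov K X x x' = K x x' - transpose (interp_columns D K X (\<lambda>z. K z x) x')"
      using \<open>x \<in> D\<close> \<open>x' \<in> D\<close> by (simp add: vec_eq_iff transpose_def kernel_transpose)
  qed (use is_arg_min_iff_interp predictive_mean_eq_interp power_function in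
      \<open>simp_all add: interp_fun_def interp_mem interp_at\<close>)
qed

end
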